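(* Let $k$ be a nonnegative integer and let $Q_k$ be the poset consisting of one minimal element covered by $k$ other elements. For any integer $j$ with $1\le j\le k-1$, the coefficient of $t^j$ in the Ehrhart polynomial $i(\mathcal{O}_{Q_k},t)$ is negative if and only if $k-j+1\ge 20$ and $4$ divides $k-j+1$. Consequently, the order polytope $\mathcal{O}_{Q_k}$ is Ehrhart positive if and only if $k<20$.
   Context: For a finite poset $(P,\le_P)$, the order polytope $\mathcal{O}_P\subset\mathbb{R}^P$ is the set of functions $f:P\to\mathbb{R}$ with $0\le f(i)\le 1$ for all $i\in P$ and $f(i)\le f(j)$ whenever $i\le_P j$; it is a lattice polytope of dimension $|P|$. For an integral polytope $\mathcal{P}$, the Ehrhart polynomial $i(\mathcal{P},t)$ is the polynomial in $t$ with $i(\mathcal{P},t)=|t\mathcal{P}\cap\mathbb{Z}^e|$ for all positive integers $t$. An integral polytope is called Ehrhart positive if all coefficients of its Ehrhart polynomial are positive. *)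

theory Defs
  imports "HOL-Analysis.Analysis" "HOL-Computational_Algebra.Polynomial"
begin

text \<open>
  A finite poset is a finite carrier \<open>P\<close> with an order relation \<open>r\<close> satisfying
  \<open>partial_order_on P r\<close>, where \<open>(i, j) \<in> r\<close> means that \<open>i\<close> is below or equal to \<open>j\<close>.
  For a finite index set \<open>E\<close>, the space of real functions on \<open>E\<close> is represented by the
  extensional functions \<open>E \<rightarrow>\<^sub>E UNIV\<close>, so that distinct HOL functions in it are distinct points
  and lattice points can be counted with \<open>card\<close>.
\<close>

definition order_polytope :: "'a set \<Rightarrow> 'a rel \<Rightarrow> ('a \<Rightarrow> real) set" where
  "order_polytope P r =
     {f \<in> P \<rightarrow>\<^sub>E UNIV. (\<forall>i\<in>P. 0 \<le> f i \<and> f i \<le> 1) \<and>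
        (\<forall>i\<in>P. \<forall>j\<in>P. (i, j) \<in> r \<longrightarrow> f i \<le> f j)}"

definition dilate :: "'a set \<Rightarrow> real \<Rightarrow> ('a \<Rightarrow> real) set \<Rightarrow> ('a \<Rightarrow> real) set" where
  "dilate E t X = (\<lambda>f. \<lambda>i\<in>E. t * f i) ` X"

definition lattice_points :: "'a set \<Rightarrow> ('a \<Rightarrow> real) set" where
  "lattice_points E = E \<rightarrow>\<^sub>E \<int>"

definition is_ehrhart_polynomial :: "'a set \<Rightarrow> ('a \<Rightarrow> real) set \<Rightarrow> real poly \<Rightarrow> bool" where
  "is_ehrhart_polynomial E X p \<longleftrightarrow>
     (\<forall>t::nat. t \<ge> 1 \<longrightarrow> poly p (real t) = real (card (dilate E (real t) X \<inter> lattice_points E)))"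

lemma is_ehrhart_polynomial_unique:
  assumes "is_ehrhart_polynomial E X p" "is_ehrhart_polynomial E X q"
  shows "p = q"
proof (rule ccontr)
  assume "p \<noteq> q"
  then have "finite {x. poly (p - q) x = 0}"
    by (intro poly_roots_finite) simp
  moreover have "real ` {1..} \<subseteq> {x. poly (p - q) x = 0}"
    using assms by (auto simp: is_ehrhart_polynomial_def)
  ultimately have "finite (real ` {1..})"
    by (rule rev_finite_subset)
  then show False
    by (simp add: finite_image_iff infinite_Ici)
qed

text \<open>Meaningful when \<open>X\<close> is an integral polytope, for which such a polynomial exists.\<close>

definition ehrhart_polynomial :: "'a set \<Rightarrow> ('a \<Rightarrow> real) set \<Rightarrow> real poly" where
  "ehrhart_polynomial E X = (THE p. is_ehrhart_polynomial E X p)"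

lemma ehrhart_polynomial_eqI:
  "is_ehrhart_polynomial E X p \<Longrightarrow> ehrhart_polynomial E X = p"
  unfolding ehrhart_polynomial_def
  by (rule the_equality) (auto intro: is_ehrhart_polynomial_unique)

definition ehrhart_positive :: "'a set \<Rightarrow> ('a \<Rightarrow> real) set \<Rightarrow> bool" where
  "ehrhart_positive E X \<longleftrightarrow>
     (\<forall>j \<le> degree (ehrhart_polynomial E X). coeff (ehrhart_polynomial E X) j > 0)"

text \<open>The minimal element is \<open>0\<close>; the \<open>k\<close> elements covering it are \<open>1, \<dots>, k\<close>.\<close>

definition Q_carrier :: "nat \<Rightarrow> nat set" where
  "Q_carrier k = {0..k}"

definition Q_order :: "nat \<Rightarrow> nat rel" where
  "Q_order k = {(i, j). i \<in> Q_carrier k \<and> j \<in> Q_carrier k \<and> (i = j \<or> i = 0)}"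

lemma Q_partial_order: "partial_order_on (Q_carrier k) (Q_order k)"
  by (auto simp: partial_order_on_def preorder_on_def refl_on_def trans_def antisym_def Q_order_def)

abbreviation Q_polytope :: "nat \<Rightarrow> (nat \<Rightarrow> real) set" where
  "Q_polytope k \<equiv> order_polytope (Q_carrier k) (Q_order k)"

end

(*
  Summing over the value at the minimal element, i(O_{Q_k}, t) = 1^k + ... + (t+1)^k.  By the
  Bernoulli formula the coefficient of t^j, for 1 <= j < k and m = k - j + 1, is
  (k choose j) (1 + B_m / m), so it is negative iff B_m < -m.  With f = (X/2) coth (X/2), whose
  coefficients are B_m / m! for m >= 2, the equation X f' = f - f^2 + X^2/4 shows that f is even,
  that the sign of B_{2n} is (-1)^{n+1}, and that |B_{2n}| / (2n) increases from n = 10 on.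
  Finally |B_20| / 20 > 1, and the values B_4, B_8, B_12, B_16 are computed exactly.
*)
theory Submission imports Defs "HOL-Computational_Algebra.Formal_Power_Series"
begin

unbundle no vec_syntax
unbundle fps_syntax

section \<open>The power series (X/2) coth(X/2) and its Riccati equation\<close>

text \<open>Allows the factor exp X - 1 to be cancelled in the integral domain of power
  series.\<close>

lemma fps_exp_1_neq_1: "fps_exp (1 :: real) \<noteq> 1"
proof
  assume "fps_exp (1 :: real) = 1"
  then have "fps_exp (1 :: real) $ 1 = 1 $ 1" by simp
  then show False by simp
qed

text \<open>
  As \<open>half_coth\<close> is the even part of \<open>X / (exp X - 1)\<close>, its coefficient at \<open>n\<close> is \<open>B\<^sub>n / n!\<close>
  with \<open>B\<^sub>n\<close> the Bernoulli number, except that it vanishes at \<open>n = 1\<close>.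
\<close>

definition half_coth :: "real fps" where
  "half_coth = fps_const (1/2) * (fps_exp 1 + 1) * inverse (fps_shift 1 (fps_exp 1 - 1))"

text \<open>Since exp X - 1 = X u with u(0) = 1, u is invertible. The form without division suits
  \<open>algebra\<close>.\<close>

lemma half_coth_mult: "half_coth * (fps_exp 1 - 1) = fps_const (1/2) * fps_X * (fps_exp 1 + 1)"
proof -
  let ?u = "fps_shift 1 (fps_exp 1 - 1) :: real fps"
  have u: "fps_exp 1 - 1 = fps_X * ?u"
    by (rule fps_ext) (simp add: fps_X_mult_nth)
  have "inverse ?u * ?u = 1"
    by (rule inverse_mult_eq_1) simp
  then show ?thesis
    unfolding half_coth_def using u by algebra
qed

lemma half_coth_0: "half_coth $ 0 = 1"
  by (simp add: half_coth_def fps_mult_nth)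

text \<open>
  This Riccati equation turns into a quadratic recursion for the Bernoulli numbers of even index
  in which all terms have the same sign.
\<close>

lemma half_coth_ode:
  "fps_X * fps_deriv half_coth = half_coth - half_coth ^ 2 + fps_const (1/4) * fps_X ^ 2"
proof -
  define E :: "real fps" where "E = fps_exp 1"
  define h :: "real fps" where "h = fps_const (1/2)"
  define f where "f = half_coth"
  have h: "h + h = 1" "fps_const (1/4) = h * h"
    by (simp_all add: h_def)
  have f: "f * (E - 1) = h * fps_X * (E + 1)"
    using half_coth_mult by (simp add: E_def h_def f_def)
  have "fps_deriv (f * (E - 1)) = fps_deriv (h * fps_X * (E + 1))"
    by (simp only: f)
  then have f': "f * E + fps_deriv f * (E - 1) = h * (E + 1) + h * fps_X * E"
    by (simp add: E_def h_def algebra_simps)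
  \<comment> \<open>After multiplication by (E - 1)^2, the equations \<open>f\<close> and
    \<open>f'\<close> eliminate the series and its derivative.\<close>
  have "(E - 1)^2 * (fps_X * fps_deriv f) = (E - 1)^2 * (f - f ^ 2 + h * h * fps_X ^ 2)"
    using h(1) f f' by algebra
  moreover have "E - 1 \<noteq> 0"
    by (simp add: E_def fps_exp_1_neq_1)
  ultimately show ?thesis
    by (simp add: f_def h(2))
qed

text \<open>Coefficients are compared in the Riccati equation. As the constant coefficient is 1, the
  end terms of the square give twice the n-th coefficient, whence the factor n + 1.\<close>

lemma half_coth_rec:
  assumes "n \<ge> 1"
  shows "(real n + 1) * half_coth $ n =
    (if n = 2 then 1/4 else 0) - (\<Sum>i=1..<n. half_coth $ i * half_coth $ (n - i))"
proof -
  have "(fps_X * fps_deriv half_coth) $ n =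
      (half_coth - half_coth ^ 2 + fps_const (1/4) * fps_X ^ 2) $ n"
    by (simp only: half_coth_ode)
  then have "real n * half_coth $ n = half_coth $ n - (half_coth * half_coth) $ n + (if n = 2 then 1/4 else 0)"
    using assms by (simp add: fps_X_mult_nth power2_eq_square[of half_coth] fps_X_power_nth)
  moreover have "(half_coth * half_coth) $ n =
      2 * half_coth $ n + (\<Sum>i=1..<n. half_coth $ i * half_coth $ (n - i))"
  proof -
    have "{0..n} = insert 0 (insert n {1..<n})" using assms by auto
    then show ?thesis using assms by (simp add: fps_mult_nth half_coth_0)
  qed
  ultimately show ?thesis by (simp add: algebra_simps)
qed

text \<open>If n is odd, one of i and n - i is odd, so by induction every product in the recursion
  vanishes.\<close>

lemma half_coth_odd: "odd n \<Longrightarrow> half_coth $ n = 0"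
proof (induction n rule: less_induct)
  case (less n)
  have "half_coth $ i * half_coth $ (n - i) = 0" if "i \<in> {1..<n}" for i
    using less.IH[of i] less.IH[of "n - i"] less.prems that by (cases "odd i") auto
  then have "(\<Sum>i=1..<n. half_coth $ i * half_coth $ (n - i)) = 0"
    by (rule sum.neutral[OF ballI])
  moreover have "n \<noteq> 2" "n \<ge> 1" using less.prems by (auto elim: oddE)
  ultimately have "(real n + 1) * half_coth $ n = 0"
    using half_coth_rec[of n] by simp
  then show ?case by (simp add: add_nonneg_eq_0_iff)
qed

section \<open>Signs and growth of the Bernoulli numbers\<close>

text \<open>The name reflects \<open>n \<ge> 1\<close>; the value at \<open>0\<close> is \<open>-1\<close>.\<close>

definition abs_coeff :: "nat \<Rightarrow> real" where
  "abs_coeff n = - ((-1) ^ n * half_coth $ (2 * n))"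

lemma half_coth_even: "half_coth $ (2 * n) = - ((-1) ^ n * abs_coeff n)"
  by (cases "even n") (simp_all add: abs_coeff_def)

lemma abs_coeff_1: "abs_coeff 1 = 1/12"
  using half_coth_rec[of 2] half_coth_odd[of 1] by (simp add: abs_coeff_def numeral_2_eq_2)

text \<open>Only even indices survive in \<open>half_coth_rec\<close>, and the signs of the two
  factors always multiply to (-1)^n. From n = 2 on the term 1/4 is absent.\<close>

lemma abs_coeff_rec:
  assumes "n \<ge> 2"
  shows "(2 * real n + 1) * abs_coeff n = (\<Sum>i=1..<n. abs_coeff i * abs_coeff (n - i))"
proof -
  have "(\<Sum>i=1..<2*n. half_coth $ i * half_coth $ (2 * n - i)) =
      (\<Sum>i\<in>(*) 2 ` {1..<n}. half_coth $ i * half_coth $ (2 * n - i))"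
  proof (rule sum.mono_neutral_right)
    show "\<forall>i\<in>{1..<2*n} - (*) 2 ` {1..<n}. half_coth $ i * half_coth $ (2 * n - i) = 0"
    proof
      fix i assume i: "i \<in> {1..<2*n} - (*) 2 ` {1..<n}"
      have "odd i"
        using i by (auto elim!: evenE)
      then show "half_coth $ i * half_coth $ (2 * n - i) = 0"
        by (simp add: half_coth_odd)
    qed
  qed auto
  also have "\<dots> = (\<Sum>i=1..<n. half_coth $ (2 * i) * half_coth $ (2 * (n - i)))"
    by (subst sum.reindex) (auto simp: inj_on_def diff_mult_distrib2)
  also have "\<dots> = (\<Sum>i=1..<n. (-1) ^ n * (abs_coeff i * abs_coeff (n - i)))"
  proof (rule sum.cong[OF refl])
    fix i assume "i \<in> {1..<n}"
    then have "(-1) ^ n = (-1 :: real) ^ i * (-1) ^ (n - i)"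
      by (simp flip: power_add)
    then show "half_coth $ (2 * i) * half_coth $ (2 * (n - i)) =
        (-1) ^ n * (abs_coeff i * abs_coeff (n - i))"
      by (simp add: half_coth_even)
  qed
  finally have "(2 * real n + 1) * half_coth $ (2 * n) =
      - ((-1) ^ n * (\<Sum>i=1..<n. abs_coeff i * abs_coeff (n - i)))"
    using half_coth_rec[of "2 * n"] assms by (simp add: sum_distrib_left)
  then show ?thesis
    by (cases "even n") (simp_all add: abs_coeff_def)
qed

lemma abs_coeff_pos: "n \<ge> 1 \<Longrightarrow> abs_coeff n > 0"
proof (induction n rule: less_induct)
  case (less n)
  show ?case
  proof (cases "n = 1")
    case True
    then show ?thesis using abs_coeff_1 by simp
  next
    case False
    with less.prems have "n \<ge> 2" by simp
    then have "(\<Sum>i=1..<n. abs_coeff i * abs_coeff (n - i)) > 0"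
      using less.IH by (intro sum_pos) auto
    then have "(2 * real n + 1) * abs_coeff n > 0"
      using abs_coeff_rec[OF \<open>n \<ge> 2\<close>] by simp
    then show ?thesis by (simp add: zero_less_mult_iff)
  qed
qed

text \<open>These are |B_{2n}| / (2n)!. Indices 2, 4, 6, 8 settle m = 4, 8, 12, 16 in the sign
  lemma; index 10 starts the growth argument.\<close>

lemma abs_coeff_values:
  "abs_coeff 2 = 1/720" "abs_coeff 3 = 1/30240" "abs_coeff 4 = 1/1209600"
  "abs_coeff 5 = 1/47900160" "abs_coeff 6 = 691/1307674368000" "abs_coeff 7 = 1/74724249600"
  "abs_coeff 8 = 3617/10670622842880000" "abs_coeff 9 = 43867/5109094217170944000"
  "abs_coeff 10 = 174611/802857662698291200000"
proof -
  have *: "(\<Sum>i=1..<n. g i) = sum_list (map g [1..<n])" for n and g :: "nat \<Rightarrow> real"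
    by (simp add: interv_sum_list_conv_sum_set_nat)
  \<comment> \<open>The simplifier turns the lower bound 1 into \<open>Suc 0\<close>, so this bound
    is split off by hand before numerals take over.\<close>
  have upt: "[Suc 0..<numeral n] = (if Suc 0 < numeral n then Suc 0 # [2..<numeral n] else [])" for n
    by (simp add: upt_rec[of "Suc 0"] numeral_2_eq_2)
  note rec = abs_coeff_rec[unfolded *]
  note S = abs_coeff_1[unfolded One_nat_def] upt
  show v2: "abs_coeff 2 = 1/720" using rec[of 2] by (simp add: S)
  show v3: "abs_coeff 3 = 1/30240" using rec[of 3] by (simp add: S v2)
  show v4: "abs_coeff 4 = 1/1209600" using rec[of 4] by (simp add: S v2 v3)
  show v5: "abs_coeff 5 = 1/47900160" using rec[of 5] by (simp add: S v2 v3 v4)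
  show v6: "abs_coeff 6 = 691/1307674368000" using rec[of 6] by (simp add: S v2 v3 v4 v5)
  show v7: "abs_coeff 7 = 1/74724249600" using rec[of 7] by (simp add: S v2 v3 v4 v5 v6)
  show v8: "abs_coeff 8 = 3617/10670622842880000"
    using rec[of 8] by (simp add: S v2 v3 v4 v5 v6 v7)
  show v9: "abs_coeff 9 = 43867/5109094217170944000"
    using rec[of 9] by (simp add: S v2 v3 v4 v5 v6 v7 v8)
  show v10: "abs_coeff 10 = 174611/802857662698291200000"
    using rec[of 10] by (simp add: S v2 v3 v4 v5 v6 v7 v8 v9)
qed

text \<open>The left side is |B_{2n}| / (2n). From n to n + 1 the coefficient shrinks at most by the
  factor 6(2n + 3), while the factorial grows by 2n(2n + 1), which is at least as large.\<close>

lemma abs_coeff_large: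
  assumes "n \<ge> 10"
  shows "fact (2 * n - 1) * abs_coeff n > 1"
  using assms
proof (induction n rule: dec_induct)
  case base
  show ?case by (simp add: abs_coeff_values fact_numeral)
next
  case (step n)
  \<comment> \<open>The two end terms of the recursion suffice; each equals
    \<open>abs_coeff n / 12\<close>.\<close>
  have "(\<Sum>i\<in>{1, n}. abs_coeff i * abs_coeff (Suc n - i)) \<le>
      (\<Sum>i=1..<Suc n. abs_coeff i * abs_coeff (Suc n - i))"
    using step.hyps by (intro sum_mono2) (auto intro!: mult_nonneg_nonneg less_imp_le[OF abs_coeff_pos])
  moreover have "(\<Sum>i\<in>{1, n}. abs_coeff i * abs_coeff (Suc n - i)) = abs_coeff n / 6"
    using step.hyps abs_coeff_1 by simp
  moreover have "(2 * real n + 3) * abs_coeff (Suc n) =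
      (\<Sum>i=1..<Suc n. abs_coeff i * abs_coeff (Suc n - i))"
    using abs_coeff_rec[of "Suc n"] step.hyps by (simp add: add_ac)
  ultimately have "abs_coeff n / 6 \<le> (2 * real n + 3) * abs_coeff (Suc n)"
    by linarith
  then have le: "abs_coeff n \<le> 6 * (2 * real n + 3) * abs_coeff (Suc n)"
    by (simp add: algebra_simps)
  \<comment> \<open>With these bounds the quadratic comparison is linear in n and the atom
    \<open>n * n\<close>.\<close>
  have "100 \<le> n * n" "10 * n \<le> n * n" using step.hyps mult_le_mono[of 10 n 10 n] by simp_all
  then have "6 * (2 * n + 3) \<le> 2 * n * (2 * n + 1)"
    using step.hyps unfolding distrib_left mult_1_right mult.assoc mult.left_commute[of n 2] by linarith
  then have "real (6 * (2 * n + 3)) \<le> real (2 * n * (2 * n + 1))"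
    by (simp only: of_nat_le_iff)
  then have "6 * (2 * real n + 3) * abs_coeff (Suc n) \<le> 2 * real n * (2 * real n + 1) * abs_coeff (Suc n)"
    using abs_coeff_pos[of "Suc n"] by (intro mult_right_mono) (simp_all add: algebra_simps)
  with le have "abs_coeff n \<le> 2 * real n * (2 * real n + 1) * abs_coeff (Suc n)"
    by simp
  then have "fact (2 * n - 1) * abs_coeff n \<le>
      fact (2 * n - 1) * (2 * real n * (2 * real n + 1) * abs_coeff (Suc n))"
    by (intro mult_left_mono) simp_all
  also have "\<dots> = fact (2 * Suc n - 1) * abs_coeff (Suc n)"
  proof -
    obtain p where "n = Suc p" using step.hyps by (cases n) auto
    then show ?thesis by (simp add: algebra_simps)
  qed
  finally show ?case using step.IH by simp
qed

text \<open>The quantity is B_m / m for m \<ge> 2. It is zero for odd m and positive for m = 2 mod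
  4; for multiples of 4 it is negative, and its size is decided by the exact values below 20 and by
  growth from 20 on.\<close>

lemma half_coth_sign:
  assumes "m \<ge> 2"
  shows "20 \<le> m \<and> 4 dvd m \<Longrightarrow> fact (m - 1) * half_coth $ m < -1"
    and "\<not> (20 \<le> m \<and> 4 dvd m) \<Longrightarrow> fact (m - 1) * half_coth $ m > -1"
proof -
  assume m: "20 \<le> m \<and> 4 dvd m"
  then obtain n where n: "m = 2 * (2 * n)" by (auto elim: dvdE)
  show "fact (m - 1) * half_coth $ m < -1"
    using abs_coeff_large[of "2 * n"] m unfolding n half_coth_even by simp
next
  assume m: "\<not> (20 \<le> m \<and> 4 dvd m)"
  consider "odd m" | n where "m = 2 * n" "odd n" | n where "m = 2 * (2 * n)" "n \<ge> 1" "n < 5"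
    using m assms by (cases "even m") (force elim!: evenE)+
  then show "fact (m - 1) * half_coth $ m > -1"
  proof cases
    case 1
    then show ?thesis by (simp add: half_coth_odd)
  next
    case 2
    then have "fact (m - 1) * half_coth $ m > 0"
      using abs_coeff_pos[of n] odd_pos[of n] by (simp add: half_coth_even)
    then show ?thesis by linarith
  next
    case 3
    from 3 have "n = 1 \<or> n = 2 \<or> n = 3 \<or> n = 4" by auto
    then have "fact (2 * (2 * n) - 1) * abs_coeff (2 * n) < 1"
      by (auto simp: abs_coeff_values fact_numeral)
    then show ?thesis unfolding 3(1) half_coth_even by simp
  qed
qed

section \<open>Bernoulli's formula for sums of powers\<close>

text \<open>Adding X/2 gives X exp X / (exp X - 1), that is, B_1 = +1/2. The sum over j is
  Bernoulli's formula for 1^k + ... + t^k, and the last summand supplies (t + 1)^k.\<close>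

definition Q_ehrhart :: "nat \<Rightarrow> real poly" where
  "Q_ehrhart k = (\<Sum>j=1..k+1.
     monom (fact k / fact j * (half_coth + fps_const (1/2) * fps_X) $ (k + 1 - j)) j) + [:1, 1:] ^ k"

text \<open>The sum is k! times the coefficient of X^k in the geometric sum of the exp(iX), which is
  evaluated in closed form.\<close>

lemma sum_powers_eq: "(\<Sum>i=1..t+1. real i ^ k) = poly (Q_ehrhart k) (real t)"
proof -
  define E :: "real \<Rightarrow> real fps" where "E = fps_exp"
  define g where "g = half_coth + fps_const (1/2) * fps_X"
  have "2 * fps_const (1/2 :: real) = 1"
    by (metis fps_const_1_eq_1 fps_const_mult fps_numeral_fps_const mult.commute nonzero_divide_eq_eq zero_neq_numeral)
  then have g: "g * (E 1 - 1) = fps_X * E 1"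
    unfolding g_def E_def using half_coth_mult by algebra
  have add: "E (a + b) = E a * E b" for a b
    by (simp add: E_def fps_exp_add_mult)
  have tel: "(\<Sum>i=1..t+1. E (real i)) * (E 1 - 1) = E 1 * (E (real t + 1) - 1)"
  proof (induction t)
    case (Suc t)
    moreover have "E (real (Suc t) + 1) = E 1 * E (real t + 1)"
      by (simp flip: add add: add_ac)
    moreover have "(\<Sum>i=1..Suc t+1. E (real i)) = (\<Sum>i=1..t+1. E (real i)) + E (real (Suc t) + 1)"
      by (simp add: add_ac)
    ultimately show ?case by algebra
  qed simp
  have "(E 1 - 1) * (fps_X * (\<Sum>i=1..t+1. E (real i))) =
      (E 1 - 1) * (g * (E (real t) - 1) + fps_X * E (real t + 1))"
    using tel g add[of "real t" 1] by algebra
  moreover have "E 1 - 1 \<noteq> 0"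
    by (simp add: E_def fps_exp_1_neq_1)
  ultimately have "fps_X * (\<Sum>i=1..t+1. E (real i)) = g * (E (real t) - 1) + fps_X * E (real t + 1)"
    by simp
  \<comment> \<open>The factor X shifts the wanted coefficient from k to k + 1.\<close>
  then have "(fps_X * (\<Sum>i=1..t+1. E (real i))) $ (k + 1) =
      ((E (real t) - 1) * g + fps_X * E (real t + 1)) $ (k + 1)"
    by (simp only: mult.commute)
  then have "(\<Sum>i=1..t+1. real i ^ k / fact k) =
      (\<Sum>j=0..k+1. (E (real t) - 1) $ j * g $ (k + 1 - j)) + (real t + 1) ^ k / fact k"
    by (simp add: fps_X_mult_nth fps_sum_nth fps_mult_nth[of _ g] E_def del: sum.cl_ivl_Suc)
  \<comment> \<open>The term j = 0 drops out because exp(tX) - 1 has no constant term.\<close>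
  also have "(\<Sum>j=0..k+1. (E (real t) - 1) $ j * g $ (k + 1 - j)) =
      (\<Sum>j=1..k+1. real t ^ j / fact j * g $ (k + 1 - j))"
    by (intro sum.mono_neutral_cong_right) (auto simp: E_def)
  finally have "fact k * (\<Sum>i=1..t+1. real i ^ k / fact k) =
      fact k * ((\<Sum>j=1..k+1. real t ^ j / fact j * g $ (k + 1 - j)) + (real t + 1) ^ k / fact k)"
    by (simp only:)
  then show ?thesis
    unfolding Q_ehrhart_def g_def[symmetric]
    by (simp add: sum_distrib_left distrib_left poly_sum poly_monom poly_power mult_ac add_ac
             del: sum.cl_ivl_Suc)
qed

lemma coeff_one_plus_X_power: "coeff ([:1, 1:] ^ n) i = (of_nat (n choose i) :: 'a :: comm_semiring_1)"
proof (cases "i \<le> n")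
  case True
  then show ?thesis by (simp add: coeff_linear_poly_power)
next
  case False
  have "degree ([:1, 1 :: 'a:] ^ n) \<le> n"
    using degree_power_le[of "[:1, 1 :: 'a:]" n] by simp
  with False show ?thesis by (simp add: coeff_eq_0 binomial_eq_0)
qed

lemma coeff_Q_ehrhart:
  "coeff (Q_ehrhart k) j =
     (if 1 \<le> j \<and> j \<le> k + 1
      then fact k / fact j * (half_coth + fps_const (1/2) * fps_X) $ (k + 1 - j) else 0) +
     real (k choose j)"
  by (simp add: Q_ehrhart_def coeff_sum coeff_one_plus_X_power sum.delta del: sum.cl_ivl_Suc)

text \<open>Here k + 1 - j \<ge> 2, so X/2 does not contribute; k!/j! is the binomial coefficient
  times (k - j)!.\<close>

lemma coeff_Q_ehrhart_mid:
  assumes "1 \<le> j" "j < k"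
  shows "coeff (Q_ehrhart k) j = real (k choose j) * (fact (k - j) * half_coth $ (k - j + 1) + 1)"
  using assms by (simp add: coeff_Q_ehrhart Suc_diff_le binomial_fact field_simps)

section \<open>Lattice points in the dilated order polytope\<close>

lemma mem_dilate_Q_polytope_iff:
  assumes "t > 0"
  shows "f \<in> dilate (Q_carrier k) t (Q_polytope k) \<longleftrightarrow>
    f \<in> {0..k} \<rightarrow>\<^sub>E UNIV \<and> (\<forall>i\<le>k. 0 \<le> f i \<and> f i \<le> t \<and> f 0 \<le> f i)"
proof
  assume "f \<in> dilate (Q_carrier k) t (Q_polytope k)"
  then show "f \<in> {0..k} \<rightarrow>\<^sub>E UNIV \<and> (\<forall>i\<le>k. 0 \<le> f i \<and> f i \<le> t \<and> f 0 \<le> f i)"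
    using assms by (auto simp: dilate_def order_polytope_def Q_carrier_def Q_order_def mult_le_cancel_left1)
next
  assume f: "f \<in> {0..k} \<rightarrow>\<^sub>E UNIV \<and> (\<forall>i\<le>k. 0 \<le> f i \<and> f i \<le> t \<and> f 0 \<le> f i)"
  have "f = (\<lambda>i\<in>{0..k}. t * (\<lambda>i\<in>{0..k}. f i / t) i)"
    using f assms by (intro extensionalityI[of _ "{0..k}"]) (auto simp: PiE_def)
  moreover have "(\<lambda>i\<in>{0..k}. f i / t) \<in> order_polytope {0..k} (Q_order k)"
    using f assms by (auto simp: order_polytope_def Q_carrier_def Q_order_def divide_right_mono)
  ultimately show "f \<in> dilate (Q_carrier k) t (Q_polytope k)"
    unfolding dilate_def Q_carrier_def by blast
qed

text \<open>Once the minimal element has value m, the other k values range freely over m, ..., t,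
  giving (t + 1 - m)^k points.\<close>

lemma card_Q_lattice_points:
  assumes "t \<ge> 1"
  shows "card (dilate (Q_carrier k) (real t) (Q_polytope k) \<inter> lattice_points (Q_carrier k)) =
    (\<Sum>i=1..t+1. i ^ k)"
proof -
  let ?L = "dilate (Q_carrier k) (real t) (Q_polytope k) \<inter> lattice_points (Q_carrier k)"
  let ?S = "SIGMA m:{0..t}. {1..k} \<rightarrow>\<^sub>E {m..t}"
  have L: "f \<in> ?L \<longleftrightarrow> f \<in> {0..k} \<rightarrow>\<^sub>E \<int> \<and> (\<forall>i\<le>k. 0 \<le> f i \<and> f i \<le> real t \<and> f 0 \<le> f i)" for f
  proof -
    have "f \<in> {0..k} \<rightarrow>\<^sub>E UNIV" if "f \<in> {0..k} \<rightarrow>\<^sub>E \<int>"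
      using that by (simp add: PiE_iff)
    moreover have "f \<in> lattice_points (Q_carrier k) \<longleftrightarrow> f \<in> {0..k} \<rightarrow>\<^sub>E \<int>"
      by (simp add: lattice_points_def Q_carrier_def)
    moreover have "real t > 0" using assms by simp
    ultimately show ?thesis
      unfolding Int_iff by (simp only: mem_dilate_Q_polytope_iff) blast
  qed
  have "bij_betw (\<lambda>(m, g). \<lambda>i\<in>{0..k}. real (if i = 0 then m else g i)) ?S ?L"
  \<comment> \<open>Lattice points have nonnegative integer values, so \<open>nat\<close> of the
    floor recovers them exactly.\<close>
  proof (rule bij_betw_byWitness[where f' = "\<lambda>f. (nat \<lfloor>f 0\<rfloor>, \<lambda>i\<in>{1..k}. nat \<lfloor>f i\<rfloor>)"])
    show "\<forall>a\<in>?S. (\<lambda>f. (nat \<lfloor>f 0\<rfloor>, \<lambda>i\<in>{1..k}. nat \<lfloor>f i\<rfloor>))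
        ((\<lambda>(m, g). \<lambda>i\<in>{0..k}. real (if i = 0 then m else g i)) a) = a" (is "\<forall>a\<in>_. ?inv a")
    proof
      fix a assume "a \<in> ?S"
      then obtain m g where a: "a = (m, g)" and "g \<in> {1..k} \<rightarrow>\<^sub>E {m..t}"
        by auto
      then have "(\<lambda>i\<in>{1..k}. g i) = g"
        by (simp only: PiE_restrict)
      moreover have "(\<lambda>i\<in>{1..k}. nat \<lfloor>(\<lambda>i\<in>{0..k}. real (if i = 0 then m else g i)) i\<rfloor>) =
          (\<lambda>i\<in>{1..k}. g i)"
        by (rule restrict_ext) simp
      ultimately show "?inv a"
        unfolding a by simp
    qed
    show "\<forall>f\<in>?L. (\<lambda>(m, g). \<lambda>i\<in>{0..k}. real (if i = 0 then m else g i))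
        (nat \<lfloor>f 0\<rfloor>, \<lambda>i\<in>{1..k}. nat \<lfloor>f i\<rfloor>) = f"
    proof
      fix f assume "f \<in> ?L"
      then have f: "f \<in> {0..k} \<rightarrow>\<^sub>E \<int>" "\<And>i. i \<le> k \<Longrightarrow> 0 \<le> f i"
        unfolding L by auto
      have "real (nat \<lfloor>f i\<rfloor>) = f i" if "i \<le> k" for i
        using f(2)[OF that] PiE_mem[OF f(1), of i] that by (auto elim!: Ints_cases)
      then show "(\<lambda>(m, g). \<lambda>i\<in>{0..k}. real (if i = 0 then m else g i))
          (nat \<lfloor>f 0\<rfloor>, \<lambda>i\<in>{1..k}. nat \<lfloor>f i\<rfloor>) = f"
        using PiE_arb[OF f(1)] by (auto simp: fun_eq_iff)
    qed
    show "(\<lambda>(m, g). \<lambda>i\<in>{0..k}. real (if i = 0 then m else g i)) ` ?S \<subseteq> ?L"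
    proof
      fix f assume "f \<in> (\<lambda>(m, g). \<lambda>i\<in>{0..k}. real (if i = 0 then m else g i)) ` ?S"
      then obtain m g where mg: "m \<le> t" "g \<in> {1..k} \<rightarrow>\<^sub>E {m..t}"
        and f: "f = (\<lambda>i\<in>{0..k}. real (if i = 0 then m else g i))"
        by auto
      have "m \<le> g i \<and> g i \<le> t" if "i \<noteq> 0" "i \<le> k" for i
        using PiE_mem[OF mg(2), of i] that by auto
      then show "f \<in> ?L"
        unfolding L f using mg(1) by auto
    qed
    show "(\<lambda>f. (nat \<lfloor>f 0\<rfloor>, \<lambda>i\<in>{1..k}. nat \<lfloor>f i\<rfloor>)) ` ?L \<subseteq> ?S"
    proof
      fix x assume "x \<in> (\<lambda>f. (nat \<lfloor>f 0\<rfloor>, \<lambda>i\<in>{1..k}. nat \<lfloor>f i\<rfloor>)) ` ?L"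
      then obtain f where f: "f \<in> ?L" and x: "x = (nat \<lfloor>f 0\<rfloor>, \<lambda>i\<in>{1..k}. nat \<lfloor>f i\<rfloor>)"
        by auto
      have "nat \<lfloor>f 0\<rfloor> \<le> nat \<lfloor>f i\<rfloor> \<and> nat \<lfloor>f i\<rfloor> \<le> t" if "i \<le> k" for i
      proof -
        have "f 0 \<le> f i" "f i \<le> real t"
          using f that unfolding L by auto
        then show ?thesis
          using nat_mono[OF floor_mono[of "f 0" "f i"]] nat_mono[OF floor_mono[of "f i" "real t"]]
          by simp
      qed
      then show "x \<in> ?S"
        unfolding x by auto
    qed
  qed
  then have "card ?L = card ?S"
    by (simp add: bij_betw_same_card)
  also have "\<dots> = (\<Sum>m\<in>{0..t}. (t + 1 - m) ^ k)"
    by (subst card_SigmaI) (auto simp: finite_PiE card_funcsetE)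
  also have "\<dots> = (\<Sum>i=1..t+1. i ^ k)"
    by (rule sum.reindex_bij_witness[where i = "\<lambda>i. t + 1 - i" and j = "\<lambda>m. t + 1 - m"]) auto
  finally show ?thesis .
qed

lemma ehrhart_polynomial_Q: "ehrhart_polynomial (Q_carrier k) (Q_polytope k) = Q_ehrhart k"
  by (rule ehrhart_polynomial_eqI)
    (simp add: is_ehrhart_polynomial_def card_Q_lattice_points flip: sum_powers_eq del: sum.cl_ivl_Suc)

section \<open>Signs of the coefficients and Ehrhart positivity\<close>

theorem theorem1p5:
  fixes k :: nat
  shows "(\<forall>j::nat. 1 \<le> j \<and> j \<le> k - 1 \<longrightarrow>
            (coeff (ehrhart_polynomial (Q_carrier k) (Q_polytope k)) j < 0 \<longleftrightarrow>
               20 \<le> k - j + 1 \<and> 4 dvd (k - j + 1))) \<and>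
         (ehrhart_positive (Q_carrier k) (Q_polytope k) \<longleftrightarrow> k < 20)"
proof -
  let ?p = "Q_ehrhart k"
  have sign: "coeff ?p j < 0 \<longleftrightarrow> 20 \<le> k - j + 1 \<and> 4 dvd (k - j + 1)"
    "\<not> (20 \<le> k - j + 1 \<and> 4 dvd (k - j + 1)) \<Longrightarrow> coeff ?p j > 0"
    if j: "1 \<le> j" "j < k" for j
  proof -
    have pos: "real (k choose j) > 0" using j by simp
    have m: "k - j + 1 \<ge> 2" using j by simp
    show pos': "\<not> (20 \<le> k - j + 1 \<and> 4 dvd (k - j + 1)) \<Longrightarrow> coeff ?p j > 0"
      using half_coth_sign(2)[OF m] pos by (simp add: coeff_Q_ehrhart_mid[OF j] zero_less_mult_iff)
    have "20 \<le> k - j + 1 \<and> 4 dvd (k - j + 1) \<Longrightarrow> coeff ?p j < 0"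
      using half_coth_sign(1)[OF m] pos by (simp add: coeff_Q_ehrhart_mid[OF j] mult_less_0_iff)
    then show "coeff ?p j < 0 \<longleftrightarrow> 20 \<le> k - j + 1 \<and> 4 dvd (k - j + 1)"
      using pos' by linarith
  qed
  have "ehrhart_positive (Q_carrier k) (Q_polytope k) \<longleftrightarrow> k < 20"
  proof
    assume *: "ehrhart_positive (Q_carrier k) (Q_polytope k)"
    show "k < 20"
    proof (rule ccontr)
      assume "\<not> k < 20"
      \<comment> \<open>The index j = k - 19 gives k - j + 1 = 20, and j \<ge> 1 because k \<ge>
        20.\<close>
      then have neg: "coeff ?p (k - 19) < 0"
        by (subst sign(1)) auto
      then have "k - 19 \<le> degree ?p"
        by (intro le_degree) simp
      with * neg show False
        by (fastforce simp: ehrhart_positive_def ehrhart_polynomial_Q)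
    qed
  next
    assume k: "k < 20"
    have "coeff ?p j > 0" if "j \<le> degree ?p" for j
    proof -
      have "degree ?p \<le> k + 1"
        by (rule degree_le) (simp add: coeff_Q_ehrhart binomial_eq_0)
      \<comment> \<open>The boundary coefficients are 1 at j = 0, 1/(k + 1) at j = k + 1, and 1/2 +
        1 at j = k \<ge> 1. In between, k < 20 forces k - j + 1 < 20.\<close>
      with that consider "j = 0" | "j = k + 1" | "j = k" "j \<ge> 1" | "1 \<le> j" "j < k"
        by linarith
      then show ?thesis
      proof cases
        case 4
        with k show ?thesis by (intro sign(2)) auto
      qed (simp_all add: coeff_Q_ehrhart half_coth_0 half_coth_odd binomial_eq_0)
    qed
    then show "ehrhart_positive (Q_carrier k) (Q_polytope k)"
      by (simp add: ehrhart_positive_def ehrhart_polynomial_Q)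
  qed
  then show ?thesis
    using sign(1) by (auto simp: ehrhart_polynomial_Q)
qed

end
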